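(* Let $\mathbf{a}\in\mathbb{R}^{n_{\mathrm e}}_{\ge0}$, $\omega>0$, $\mathbf{Q}\in\mathbb{R}^{n_{\mathrm{dof}}\times q}$, $\overline{p}_{\mathrm R}>0$, and $c_1,c_2\in\mathbb{R}$ with $c_1^2+c_2^2=1$. Put $\mathbf{S}:=\mathbf{K}(\mathbf{a})-\omega^2\mathbf{M}(\mathbf{a})$. The following are equivalent: (1) $\mathbf{S}\succeq\mathbf{0}$, $\ \mathcal{R}(\mathbf{Q})\subseteq\mathcal{R}(\mathbf{S})$, and the robust peak input power satisfies $$\sup_{\mathbf{e}\in\mathbb{R}^q,\ \lVert\mathbf{e}\rVert_2\le1}\ \sup_{t\in\mathbb{R}}\ \big\lvert\mathbf{f}_{\mathrm R}(t,\mathbf{e})^{\mathsf T}\mathbf{v}(t,\mathbf{e})\big\rvert\le\overline{p}_{\mathrm R};$$ (2) $\begin{pmatrix}\frac{2\overline{p}_{\mathrm R}}{\omega}\mathbf{I}_q & -\mathbf{Q}^{\mathsf T}\\ -\mathbf{Q} & \mathbf{K}(\mathbf{a})-\omega^2\mathbf{M}(\mathbf{a})\end{pmatrix}\succeq\mathbf{0}$.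
   Context: For $\mathbf{a}\in\mathbb{R}^{n_{\mathrm e}}_{\ge 0}$ the stiffness and mass matrices are $\mathbf{K}(\mathbf{a})=\sum_{e=1}^{n_{\mathrm e}}\big[a_e\mathbf{K}^{(1)}_e+a_e^2\mathbf{K}^{(2)}_e+a_e^3\mathbf{K}^{(3)}_e\big]$ and $\mathbf{M}(\mathbf{a})=\mathbf{M}^{(0)}+\sum_{e=1}^{n_{\mathrm e}}a_e\mathbf{M}^{(1)}_e$, where all $\mathbf{K}^{(i)}_e$, $\mathbf{M}^{(0)}$, $\mathbf{M}^{(1)}_e$ are fixed real symmetric positive semidefinite $n_{\mathrm{dof}}\times n_{\mathrm{dof}}$ matrices. The uncertain harmonic load is $\mathbf{f}_{\mathrm R}(t,\mathbf{e})=\big(c_1\cos(\omega t)+c_2\sin(\omega t)\big)\mathbf{Q}\mathbf{e}$. When $\mathbf{Q}\mathbf{e}\in\mathcal{R}(\mathbf{S})$, the harmonic velocity response of $\mathbf{K}(\mathbf{a})\mathbf{v}+\mathbf{M}(\mathbf{a})\mathbf{v}''=\mathbf{f}_{\mathrm R}'$ (primes denote time derivatives) is taken to be $\mathbf{v}(t,\mathbf{e})=\big(c_2\cos(\omega t)-c_1\sin(\omega t)\big)\,\omega\,\mathbf{S}^{\dagger}\mathbf{Q}\mathbf{e}$. $\mathbf{A}\succeq\mathbf{0}$ means that the real symmetric matrix $\mathbf{A}$ is positive semidefinite, $\mathcal{R}(\cdot)$ is the range (column space), $(\cdot)^{\dagger}$ the Moore-Penrose pseudoinverse, $\mathbf{I}_q$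 the $q\times q$ identity. *)

theory Defs
  imports "HOL-Analysis.Analysis"
begin

definition psd :: "real ^ 'n ^ 'n \<Rightarrow> bool" where
  "psd A \<longleftrightarrow> transpose A = A \<and> (\<forall>x. 0 \<le> x \<bullet> (A *v x))"

definition mat_range :: "real ^ 'm ^ 'n \<Rightarrow> (real ^ 'n) set" where
  "mat_range A = range (\<lambda>x. A *v x)"

text \<open>The four Penrose equations; every real matrix \<open>A\<close> has exactly one solution \<open>X\<close>.\<close>

definition is_pseudoinverse :: "real ^ 'm ^ 'n \<Rightarrow> real ^ 'n ^ 'm \<Rightarrow> bool" where
  "is_pseudoinverse A X \<longleftrightarrow>
     A ** X ** A = A \<and> X ** A ** X = X \<and>
     transpose (A ** X) = A ** X \<and> transpose (X ** A) = X ** A"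

definition pseudoinverse :: "real ^ 'm ^ 'n \<Rightarrow> real ^ 'n ^ 'm" where
  "pseudoinverse A = (THE X. is_pseudoinverse A X)"

definition block_matrix ::
  "real ^ 'c ^ 'r \<Rightarrow> real ^ 'd ^ 'r \<Rightarrow> real ^ 'c ^ 's \<Rightarrow> real ^ 'd ^ 's
     \<Rightarrow> real ^ ('c + 'd) ^ ('r + 's)" where
  "block_matrix A B C D = (\<chi> i j.
     (case i of
        Inl r \<Rightarrow> (case j of Inl c \<Rightarrow> A $ r $ c | Inr d \<Rightarrow> B $ r $ d)
      | Inr s \<Rightarrow> (case j of Inl c \<Rightarrow> C $ s $ c | Inr d \<Rightarrow> D $ s $ d)))"

definition stiffness ::
  "('e::finite \<Rightarrow> real ^ 'n ^ 'n) \<Rightarrow> ('e \<Rightarrow> real ^ 'n ^ 'n) \<Rightarrow> ('e \<Rightarrow> real ^ 'n ^ 'n)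
     \<Rightarrow> real ^ 'e \<Rightarrow> real ^ 'n ^ 'n" where
  "stiffness K1 K2 K3 a =
     (\<Sum>e\<in>UNIV. (a $ e) *\<^sub>R K1 e + (a $ e)^2 *\<^sub>R K2 e + (a $ e)^3 *\<^sub>R K3 e)"

definition mass ::
  "real ^ 'n ^ 'n \<Rightarrow> ('e::finite \<Rightarrow> real ^ 'n ^ 'n) \<Rightarrow> real ^ 'e \<Rightarrow> real ^ 'n ^ 'n" where
  "mass M0 M1 a = M0 + (\<Sum>e\<in>UNIV. (a $ e) *\<^sub>R M1 e)"

definition load ::
  "real \<Rightarrow> real \<Rightarrow> real \<Rightarrow> real ^ 'q ^ 'n \<Rightarrow> real \<Rightarrow> real ^ 'q \<Rightarrow> real ^ 'n" where
  "load c1 c2 \<omega> Q t e = (c1 * cos (\<omega> * t) + c2 * sin (\<omega> * t)) *\<^sub>R (Q *v e)"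

text \<open>Harmonic velocity response with dynamic stiffness \<open>S\<close>; it solves the time-differentiated
  equation of motion when \<open>Q *v e\<close> lies in the range of \<open>S\<close>.\<close>

definition velocity ::
  "real \<Rightarrow> real \<Rightarrow> real \<Rightarrow> real ^ 'q ^ 'n \<Rightarrow> real ^ 'n ^ 'n
     \<Rightarrow> real \<Rightarrow> real ^ 'q \<Rightarrow> real ^ 'n" where
  "velocity c1 c2 \<omega> Q S t e =
     ((c2 * cos (\<omega> * t) - c1 * sin (\<omega> * t)) * \<omega>) *\<^sub>R (pseudoinverse S *v (Q *v e))"

text \<open>Extended reals make both suprema unconditional: no boundedness proviso is hidden.\<close>

definition robust_peak_power ::
  "real \<Rightarrow> real \<Rightarrow> real \<Rightarrow> real ^ 'q ^ 'n \<Rightarrow> real ^ 'n ^ 'n \<Rightarrow> ereal" where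
  "robust_peak_power c1 c2 \<omega> Q S =
     (SUP e\<in>{e. norm e \<le> 1}. SUP t\<in>UNIV.
        ereal \<bar>load c1 c2 \<omega> Q t e \<bullet> velocity c1 c2 \<omega> Q S t e\<bar>)"

end

theory Submission
  imports Defs
begin

text \<open>
  The load and the velocity have the scalar time factors \<open>c1 cos + c2 sin\<close> and
  \<open>c2 cos - c1 sin\<close>. As \<open>c1\<^sup>2 + c2\<^sup>2 = 1\<close>, their squares add up to \<open>1\<close> at every time, so
  the absolute value of their product is at most \<open>1/2\<close>, and this value is attained an eighth of
  a period after the peak of the load. The inner supremum is therefore
  \<open>(\<omega> / 2) \<bar>Q e \<bullet> S\<^sup>\<dagger> Q e\<bar>\<close>, and the power bound says that the quadratic form
  \<open>Q e \<bullet> S\<^sup>\<dagger> Q e\<close> is at most \<open>(2 p / \<omega>) \<parallel>e\<parallel>\<^sup>2\<close>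
  (\<open>robust_peak_power_le_iff\<close>).

  The rest is the Schur complement criterion with a singular lower right block
  (\<open>psd_block_scaled_mat_iff\<close>). The quadratic form of the block matrix at \<open>(e, z)\<close> is
  \<open>(2 p / \<omega>) \<parallel>e\<parallel>\<^sup>2 - 2 z \<bullet> Q e + z \<bullet> S z\<close>. If it is nonnegative, then \<open>S\<close> is
  positive semidefinite (put \<open>e = 0\<close>), every \<open>Q e\<close> is orthogonal to the kernel of \<open>S\<close>
  (otherwise the form is unbounded below in a kernel direction) and so lies in the range of \<open>S\<close>,
  and \<open>z = S\<^sup>\<dagger> Q e\<close> gives the bound. Conversely, with \<open>y = S\<^sup>\<dagger> Q e\<close> and \<open>Q e = S y\<close>,
  completing the square leaves \<open>(2 p / \<omega>) \<parallel>e\<parallel>\<^sup>2 - y \<bullet> S y\<close> plus the nonnegative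
  \<open>(z - y) \<bullet> S (z - y)\<close>.

  Since the pseudoinverse is a definite description, its properties rest on existence and uniqueness
  of a solution of the Penrose equations.
\<close>

section \<open>Existence and uniqueness of the pseudoinverse\<close>

lemma inner_transpose:
  fixes A :: "real ^ 'm ^ 'n"
  shows "(transpose A *v x) \<bullet> y = x \<bullet> (A *v y)"
  by (simp add: dot_lmul_matrix)

lemma is_pseudoinverse_unique:
  fixes A :: "real ^ 'm ^ 'n"
  assumes X: "is_pseudoinverse A X" and Y: "is_pseudoinverse A Y"
  shows "X = Y"
proof -
  have AXY: "A ** X = A ** Y"
  proof -
    have "A ** X = transpose X ** transpose A"
      using X by (metis is_pseudoinverse_def matrix_transpose_mul)
    also have "transpose A = transpose A ** (A ** Y)"
      using Y by (metis is_pseudoinverse_def matrix_transpose_mul)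
    also have "transpose X ** (transpose A ** (A ** Y)) = (A ** X) ** (A ** Y)"
      using X by (metis is_pseudoinverse_def matrix_transpose_mul matrix_mul_assoc)
    also have "\<dots> = A ** Y"
      using X by (metis is_pseudoinverse_def matrix_mul_assoc)
    finally show ?thesis .
  qed
  have XYA: "X ** A = Y ** A"
  proof -
    have "X ** A = transpose A ** transpose X"
      using X by (metis is_pseudoinverse_def matrix_transpose_mul)
    also have "transpose A = (Y ** A) ** transpose A"
      using Y by (metis is_pseudoinverse_def matrix_transpose_mul matrix_mul_assoc)
    also have "((Y ** A) ** transpose A) ** transpose X = (Y ** A) ** (X ** A)"
      using X by (metis is_pseudoinverse_def matrix_transpose_mul matrix_mul_assoc)
    also have "\<dots> = Y ** A"
      using X by (metis is_pseudoinverse_def matrix_mul_assoc)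
    finally show ?thesis .
  qed
  have "X = X ** A ** X" using X by (simp add: is_pseudoinverse_def)
  also have "\<dots> = Y ** A ** Y" by (metis AXY XYA matrix_mul_assoc)
  also have "\<dots> = Y" using Y by (simp add: is_pseudoinverse_def)
  finally show ?thesis .
qed

text \<open>The pseudoinverse sends \<open>b\<close> to the least-squares solution of minimal norm: the one that
  lies in the row space. Existence comes from projecting \<open>b\<close> onto the column space
  and then a preimage of the projection onto the row space.\<close>

lemma ex_least_squares_in_row_space:
  fixes A :: "real ^ 'm ^ 'n"
  shows "\<exists>x \<in> mat_range (transpose A). transpose A *v (b - A *v x) = 0"
proof -
  have sub: "subspace (mat_range B)" for B :: "real ^ 'k ^ 'l"
    unfolding mat_range_def
    by (rule linear_subspace_image[OF matrix_vector_mul_linear subspace_UNIV])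
  obtain y z where y: "y \<in> mat_range A" and z: "\<And>w. w \<in> mat_range A \<Longrightarrow> orthogonal z w"
    and b: "b = y + z"
    using orthogonal_subspace_decomp_exists[of "mat_range A" b] sub[of A]
    by (metis span_eq_iff)
  obtain w where w: "y = A *v w" using y by (auto simp: mat_range_def)
  obtain x k where x: "x \<in> mat_range (transpose A)"
    and k: "\<And>u. u \<in> mat_range (transpose A) \<Longrightarrow> orthogonal k u" and wx: "w = x + k"
    using orthogonal_subspace_decomp_exists[of "mat_range (transpose A)" w] sub[of "transpose A"]
    by (metis span_eq_iff)
  have "k \<bullet> (transpose A *v (A *v k)) = 0"
    using k[of "transpose A *v (A *v k)"] by (auto simp: mat_range_def orthogonal_def)
  then have "(A *v k) \<bullet> (A *v k) = 0"
    by (metis inner_commute inner_transpose)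
  then have "A *v k = 0" by simp
  then have "b - A *v x = z"
    using b w wx by (simp add: matrix_vector_right_distrib)
  moreover have "(transpose A *v z) \<bullet> (transpose A *v z) = 0"
    using z[of "A *v (transpose A *v z)"]
    by (simp only: inner_transpose) (auto simp: mat_range_def orthogonal_def)
  ultimately show ?thesis using x by auto
qed

lemma row_space_kernel_trivial:
  fixes A :: "real ^ 'm ^ 'n"
  assumes "x \<in> mat_range (transpose A)" and "A *v x = 0"
  shows "x = 0"
proof -
  obtain y where y: "x = transpose A *v y" using assms(1) by (auto simp: mat_range_def)
  have "x \<bullet> x = y \<bullet> (A *v x)" by (metis y inner_transpose)
  then show ?thesis using assms(2) by simp
qed

lemma kernel_gram:
  fixes A :: "real ^ 'm ^ 'n"
  assumes "transpose A *v (A *v x) = 0"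
  shows "A *v x = 0"
proof -
  have "(A *v x) \<bullet> (A *v x) = (transpose A *v (A *v x)) \<bullet> x"
    by (simp only: inner_transpose)
  then show ?thesis using assms by simp
qed

text \<open>The minimal-norm least-squares solution is unique, hence linear in the right-hand side, and
  its matrix solves the Penrose equations: \<open>A X\<close> and \<open>X A\<close> are the orthogonal
  projections onto the column space and the row space.\<close>

lemma ex_is_pseudoinverse:
  fixes A :: "real ^ 'm ^ 'n"
  shows "\<exists>X. is_pseudoinverse A X"
proof -
  obtain f where fr: "\<And>b. f b \<in> mat_range (transpose A)"
    and f0: "\<And>b. transpose A *v (b - A *v f b) = 0"
    using ex_least_squares_in_row_space[of A] by metis
  have sub: "subspace (mat_range (transpose A))"
    unfolding mat_range_def
    by (rule linear_subspace_image[OF matrix_vector_mul_linear subspace_UNIV])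
  have uniq: "f b = x"
    if x: "x \<in> mat_range (transpose A)" and "transpose A *v (b - A *v x) = 0" for b x
  proof -
    have "transpose A *v (A *v (f b - x)) = 0"
      using that(2) f0[of b] by (simp add: matrix_vector_mult_diff_distrib del: transpose_matrix_vector)
    then have "A *v (f b - x) = 0" by (rule kernel_gram)
    with row_space_kernel_trivial subspace_diff[OF sub fr x] show ?thesis
      by (metis eq_iff_diff_eq_0)
  qed
  have "linear f"
  proof (rule linearI)
    fix b c
    have "transpose A *v ((b + c) - A *v (f b + f c))
        = transpose A *v (b - A *v f b) + transpose A *v (c - A *v f c)"
      by (simp add: matrix_vector_mult_diff_distrib matrix_vector_right_distrib
          del: transpose_matrix_vector)
    then show "f (b + c) = f b + f c"
      using uniq subspace_add[OF sub fr fr] f0 by simp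
  next
    fix r b
    have "transpose A *v (r *\<^sub>R b - A *v (r *\<^sub>R f b)) = r *\<^sub>R (transpose A *v (b - A *v f b))"
      by (simp add: matrix_vector_mult_diff_distrib matrix_vector_mult_scaleR scaleR_diff_right
          del: transpose_matrix_vector)
    then show "f (r *\<^sub>R b) = r *\<^sub>R f b"
      using uniq subspace_scale[OF sub fr] f0 by simp
  qed
  define X where "X = matrix f"
  have X: "X *v b = f b" for b
    unfolding X_def using \<open>linear f\<close> by (simp add: matrix_works)
  have AfA: "A *v f (A *v w) = A *v w" for w
  proof -
    have "transpose A *v (A *v (w - f (A *v w))) = 0"
      using f0[of "A *v w"] by (simp add: matrix_vector_mult_diff_distrib del: transpose_matrix_vector)
    then have "A *v (w - f (A *v w)) = 0" by (rule kernel_gram)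
    then show ?thesis by (simp add: matrix_vector_mult_diff_distrib)
  qed
  have fAf: "f (A *v f b) = f b" for b
    by (rule uniq[OF fr]) simp
  have symI: "transpose P = P"
    if "\<And>u v. (P *v u) \<bullet> v = (P *v u) \<bullet> (P *v v)" for P :: "real ^ 'k ^ 'k"
  proof -
    have "(transpose P *v u) \<bullet> v = (P *v u) \<bullet> v" for u v
      by (metis inner_commute inner_transpose that)
    then have "transpose P *v u = P *v u" for u
      using vector_eq_rdot by blast
    then show ?thesis by (simp add: matrix_eq)
  qed
  have AX: "(A *v f u) \<bullet> v = (A *v f u) \<bullet> (A *v f v)" for u v
  proof -
    have "(A *v f u) \<bullet> (v - A *v f v) = f u \<bullet> (transpose A *v (v - A *v f v))"
      by (metis inner_commute inner_transpose)
    then show ?thesis using f0 by (simp add: inner_diff_right)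
  qed
  have XA: "f (A *v u) \<bullet> v = f (A *v u) \<bullet> f (A *v v)" for u v
  proof -
    obtain y where y: "f (A *v u) = transpose A *v y" using fr by (auto simp: mat_range_def)
    have "f (A *v u) \<bullet> (v - f (A *v v)) = y \<bullet> (A *v (v - f (A *v v)))"
      unfolding y by (rule inner_transpose)
    also have "\<dots> = 0" using AfA by (simp add: matrix_vector_mult_diff_distrib)
    finally show ?thesis by (simp add: inner_diff_right)
  qed
  have "is_pseudoinverse A X"
    unfolding is_pseudoinverse_def
  proof (intro conjI)
    show "A ** X ** A = A" "X ** A ** X = X"
      by (simp_all add: matrix_eq X AfA fAf flip: matrix_vector_mul_assoc)
    show "transpose (A ** X) = A ** X"
      by (rule symI) (simp only: X matrix_vector_mul_assoc[symmetric], rule AX)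
    show "transpose (X ** A) = X ** A"
      by (rule symI) (simp only: X matrix_vector_mul_assoc[symmetric], rule XA)
  qed
  then show ?thesis ..
qed

lemma is_pseudoinverse_pseudoinverse: "is_pseudoinverse A (pseudoinverse A)"
  unfolding pseudoinverse_def
  by (metis ex_is_pseudoinverse is_pseudoinverse_unique theI)

lemma pseudoinverse_mult_range:
  assumes "b \<in> mat_range A"
  shows "A *v (pseudoinverse A *v b) = b"
  using assms is_pseudoinverse_pseudoinverse[of A]
  by (auto simp: mat_range_def is_pseudoinverse_def matrix_vector_mul_assoc)

text \<open>For symmetric \<open>A\<close> the range is the orthogonal complement of the kernel: the residual
  \<open>b - A A\<^sup>\<dagger> b\<close> lies in the kernel and is orthogonal to the range.\<close>

lemma mem_mat_range_symmetric:
  fixes A :: "real ^ 'n ^ 'n"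
  assumes sym: "transpose A = A" and ker: "\<And>z. A *v z = 0 \<Longrightarrow> z \<bullet> b = 0"
  shows "b \<in> mat_range A"
proof -
  define P where "P = A ** pseudoinverse A"
  define u where "u = b - P *v b"
  have P: "transpose P = P" "P ** A = A"
    using is_pseudoinverse_pseudoinverse[of A] by (simp_all add: P_def is_pseudoinverse_def)
  have "A ** P = A" by (metis P sym matrix_transpose_mul)
  then have Au: "A *v u = 0"
    by (simp add: u_def matrix_vector_mult_diff_distrib matrix_vector_mul_assoc)
  have "u \<bullet> (P *v b) = (A *v u) \<bullet> (pseudoinverse A *v b)"
    unfolding P_def by (metis sym inner_transpose matrix_vector_mul_assoc)
  then have "u \<bullet> u = 0"
    using Au ker[OF Au] by (simp add: u_def inner_diff_right)
  then have "b = A *v (pseudoinverse A *v b)"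
    by (simp add: u_def P_def matrix_vector_mul_assoc)
  then show ?thesis unfolding mat_range_def by blast
qed

section \<open>The Schur complement criterion\<close>

lemma sum_UNIV_sum_type:
  fixes f :: "'a::finite + 'b::finite \<Rightarrow> real"
  shows "sum f UNIV = (\<Sum>i\<in>UNIV. f (Inl i)) + (\<Sum>j\<in>UNIV. f (Inr j))"
  by (subst UNIV_Plus_UNIV[symmetric], subst sum.Plus) simp_all

lemma quadratic_form_block:
  fixes Q :: "real ^ 'q ^ 'n" and S :: "real ^ 'n ^ 'n"
  shows "w \<bullet> (block_matrix (c *\<^sub>R mat 1) (- transpose Q) (- Q) S *v w)
    = c * ((\<chi> i. w $ Inl i) \<bullet> (\<chi> i. w $ Inl i))
      - 2 * ((\<chi> j. w $ Inr j) \<bullet> (Q *v (\<chi> i. w $ Inl i)))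
      + (\<chi> j. w $ Inr j) \<bullet> (S *v (\<chi> j. w $ Inr j))"
    (is "_ = c * (?x \<bullet> ?x) - 2 * (?z \<bullet> (Q *v ?x)) + ?z \<bullet> (S *v ?z)")
proof -
  let ?B = "block_matrix (c *\<^sub>R mat 1) (- transpose Q) (- Q) S"
  have l: "(?B *v w) $ Inl i = (c *\<^sub>R ?x - transpose Q *v ?z) $ i" for i
  proof -
    have "(?B *v w) $ Inl i
        = (((c *\<^sub>R mat 1) *v ?x) + (- transpose Q) *v ?z) $ i"
      by (simp add: matrix_vector_mult_def block_matrix_def sum_UNIV_sum_type)
    also have "\<dots> = (c *\<^sub>R ?x - transpose Q *v ?z) $ i"
      by (simp add: scaleR_matrix_vector_assoc[symmetric] del: transpose_matrix_vector)
        (simp add: matrix_vector_mult_def sum_negf)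
    finally show ?thesis .
  qed
  have r: "(?B *v w) $ Inr j = (S *v ?z - Q *v ?x) $ j" for j
    by (simp add: matrix_vector_mult_def block_matrix_def sum_UNIV_sum_type sum_negf)
  have form: "w \<bullet> (?B *v w) = ?x \<bullet> (c *\<^sub>R ?x - transpose Q *v ?z) + ?z \<bullet> (S *v ?z - Q *v ?x)"
    unfolding inner_vec_def[of w] sum_UNIV_sum_type l r by (simp add: inner_vec_def)
  have cross: "?x \<bullet> (transpose Q *v ?z) = ?z \<bullet> (Q *v ?x)"
    by (metis inner_commute inner_transpose)
  show ?thesis
    unfolding form inner_diff_right cross inner_scaleR_right by simp
qed

lemma transpose_block_eq_iff:
  fixes Q :: "real ^ 'q ^ 'n" and S :: "real ^ 'n ^ 'n"
  shows "transpose (block_matrix (c *\<^sub>R mat 1) (- transpose Q) (- Q) S)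
      = block_matrix (c *\<^sub>R mat 1) (- transpose Q) (- Q) S \<longleftrightarrow> transpose S = S"
proof
  assume L: "transpose (block_matrix (c *\<^sub>R mat 1) (- transpose Q) (- Q) S)
      = block_matrix (c *\<^sub>R mat 1) (- transpose Q) (- Q) S"
  have "transpose S $ i $ j = S $ i $ j" for i j
    using arg_cong[OF L, of "\<lambda>B. B $ Inr i $ Inr j"]
    by (simp add: transpose_def block_matrix_def)
  then show "transpose S = S" by (simp add: vec_eq_iff)
next
  assume "transpose S = S"
  then have "S $ i $ j = S $ j $ i" for i j by (metis transpose_def vec_lambda_beta)
  then show "transpose (block_matrix (c *\<^sub>R mat 1) (- transpose Q) (- Q) S)
      = block_matrix (c *\<^sub>R mat 1) (- transpose Q) (- Q) S"
    by (auto simp: vec_eq_iff transpose_def block_matrix_def mat_def split: sum.split)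
qed

lemma psd_block_iff_quadratic_form:
  fixes Q :: "real ^ 'q ^ 'n" and S :: "real ^ 'n ^ 'n"
  shows "psd (block_matrix (c *\<^sub>R mat 1) (- transpose Q) (- Q) S) \<longleftrightarrow>
    transpose S = S \<and> (\<forall>x z. 0 \<le> c * (x \<bullet> x) - 2 * (z \<bullet> (Q *v x)) + z \<bullet> (S *v z))"
    (is "_ \<longleftrightarrow> _ \<and> (\<forall>x z. 0 \<le> ?q x z)")
proof -
  have "(\<forall>w :: real ^ ('q + 'n). 0 \<le> ?q (\<chi> i. w $ Inl i) (\<chi> j. w $ Inr j)) \<longleftrightarrow> (\<forall>x z. 0 \<le> ?q x z)"
    (is "?L \<longleftrightarrow> ?R")
  proof
    assume L: ?L
    show ?R
    proof (intro allI)
      fix x z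
      show "0 \<le> ?q x z"
        using L[rule_format, of "\<chi> k. case k of Inl i \<Rightarrow> x $ i | Inr j \<Rightarrow> z $ j"] by simp
    qed
  qed blast
  then show ?thesis
    unfolding psd_def transpose_block_eq_iff quadratic_form_block by blast
qed

text \<open>The Schur complement of a possibly singular lower right block: the range inclusion takes the
  place of its invertibility.\<close>

lemma psd_block_scaled_mat_iff:
  fixes Q :: "real ^ 'q ^ 'n" and S :: "real ^ 'n ^ 'n"
  shows "psd (block_matrix (c *\<^sub>R mat 1) (- transpose Q) (- Q) S) \<longleftrightarrow>
    psd S \<and> mat_range Q \<subseteq> mat_range S \<and>
    (\<forall>x. (Q *v x) \<bullet> (pseudoinverse S *v (Q *v x)) \<le> c * (x \<bullet> x))"
    (is "?L \<longleftrightarrow> ?R")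
proof
  assume ?L
  then have sym: "transpose S = S"
    and q: "\<And>x z. 0 \<le> c * (x \<bullet> x) - 2 * (z \<bullet> (Q *v x)) + z \<bullet> (S *v z)"
    by (auto simp: psd_block_iff_quadratic_form)
  have psd: "psd S"
    unfolding psd_def using sym q[of 0] by simp
  have range: "Q *v x \<in> mat_range S" for x
  proof (rule mem_mat_range_symmetric[OF sym])
    fix z assume z: "S *v z = 0"
    show "z \<bullet> (Q *v x) = 0"
    proof (rule ccontr)
      assume nz: "z \<bullet> (Q *v x) \<noteq> 0"
      \<comment> \<open>Along the kernel direction \<open>z\<close> the form is affine in the multiplier of \<open>z\<close>;
        this multiplier gives it the value \<open>-1\<close>.\<close>
      define t where "t = (c * (x \<bullet> x) + 1) / (2 * (z \<bullet> (Q *v x)))"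
      have "0 \<le> c * (x \<bullet> x) - 2 * (t * (z \<bullet> (Q *v x)))"
        using q[of x "t *\<^sub>R z"] z by (simp add: matrix_vector_mult_scaleR)
      moreover have "2 * (t * (z \<bullet> (Q *v x))) = c * (x \<bullet> x) + 1"
        using nz by (simp add: t_def)
      ultimately show False by linarith
    qed
  qed
  have "(Q *v x) \<bullet> (pseudoinverse S *v (Q *v x)) \<le> c * (x \<bullet> x)" for x
    using q[of x "pseudoinverse S *v (Q *v x)"]
    by (simp add: pseudoinverse_mult_range[OF range] inner_commute)
  with psd range show ?R by (auto simp: mat_range_def[of Q])
next
  assume R: ?R
  then have sym: "transpose S = S" and pos: "\<And>z. 0 \<le> z \<bullet> (S *v z)"
    by (auto simp: psd_def)
  have "0 \<le> c * (x \<bullet> x) - 2 * (z \<bullet> (Q *v x)) + z \<bullet> (S *v z)" for x z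
  proof -
    define y where "y = pseudoinverse S *v (Q *v x)"
    have y: "S *v y = Q *v x"
      unfolding y_def using R by (intro pseudoinverse_mult_range) (auto simp: mat_range_def)
    have "(Q *v x) \<bullet> y \<le> c * (x \<bullet> x)" using R by (simp add: y_def)
    moreover have "y \<bullet> (S *v z) = z \<bullet> (Q *v x)"
      by (metis inner_commute inner_transpose sym y)
    moreover have "0 \<le> (z - y) \<bullet> (S *v (z - y))" by (rule pos)
    ultimately show ?thesis
      by (simp add: matrix_vector_mult_diff_distrib inner_diff_left inner_diff_right y inner_commute)
  qed
  with sym show ?L by (simp add: psd_block_iff_quadratic_form)
qed

section \<open>The robust peak power\<close>

lemma abs_phase_product_le:
  fixes c1 c2 x :: real
  assumes "c1^2 + c2^2 = 1"
  shows "\<bar>(c1 * cos x + c2 * sin x) * (c2 * cos x - c1 * sin x)\<bar> \<le> 1/2"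
proof -
  define u v where "u = c1 * cos x + c2 * sin x" and "v = c2 * cos x - c1 * sin x"
  have "u^2 + v^2 = (c1^2 + c2^2) * ((sin x)^2 + (cos x)^2)" unfolding u_def v_def by algebra
  then have "u^2 + v^2 = 1" using assms by simp
  moreover have "0 \<le> (u - v)^2" "0 \<le> (u + v)^2" by simp_all
  ultimately have "\<bar>u * v\<bar> \<le> 1/2" by (simp add: power2_diff power2_sum abs_le_iff)
  then show ?thesis by (simp add: u_def v_def)
qed

lemma ex_phase_product_half:
  fixes c1 c2 \<omega> :: real
  assumes "c1^2 + c2^2 = 1" and "\<omega> \<noteq> 0"
  shows "\<exists>t. \<bar>(c1 * cos (\<omega> * t) + c2 * sin (\<omega> * t)) * (c2 * cos (\<omega> * t) - c1 * sin (\<omega> * t))\<bar> = 1/2"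
proof -
  obtain \<phi> where \<phi>: "c1 = cos \<phi>" "c2 = sin \<phi>"
    using sincos_total_2pi[OF assms(1)] by metis
  have 1: "c1 * cos (\<phi> + pi/4) + c2 * sin (\<phi> + pi/4) = cos (pi/4)"
    using cos_diff[of "\<phi> + pi/4" \<phi>] by (simp add: \<phi> mult.commute)
  have 2: "c2 * cos (\<phi> + pi/4) - c1 * sin (\<phi> + pi/4) = - sin (pi/4)"
    using sin_diff[of "\<phi> + pi/4" \<phi>] by (simp add: \<phi> mult.commute)
  have "\<omega> * ((\<phi> + pi/4) / \<omega>) = \<phi> + pi/4" using assms(2) by simp
  then show ?thesis
    by (intro exI[of _ "(\<phi> + pi/4) / \<omega>"]) (simp only: 1 2, simp add: cos_45 sin_45)
qed

text \<open>Both sides are homogeneous of degree two in the amplitude, so the bound on the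
  unit ball extends to all amplitudes.\<close>

lemma robust_peak_power_le_iff:
  fixes Q :: "real ^ 'q ^ 'n" and S :: "real ^ 'n ^ 'n"
  assumes c: "c1^2 + c2^2 = 1" and "\<omega> > 0"
  shows "robust_peak_power c1 c2 \<omega> Q S \<le> ereal p \<longleftrightarrow>
    (\<forall>x. \<bar>(Q *v x) \<bullet> (pseudoinverse S *v (Q *v x))\<bar> \<le> (2 * p / \<omega>) * (x \<bullet> x))"
proof -
  let ?g = "\<lambda>x. (Q *v x) \<bullet> (pseudoinverse S *v (Q *v x))"
  let ?k = "\<lambda>t. (c1 * cos (\<omega> * t) + c2 * sin (\<omega> * t)) * (c2 * cos (\<omega> * t) - c1 * sin (\<omega> * t))"
  have power: "\<bar>load c1 c2 \<omega> Q t e \<bullet> velocity c1 c2 \<omega> Q S t e\<bar> = \<bar>?k t\<bar> * (\<omega> * \<bar>?g e\<bar>)" for t e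
    using \<open>\<omega> > 0\<close> by (simp add: load_def velocity_def abs_mult mult_ac)
  have time: "(\<forall>t. \<bar>?k t\<bar> * (\<omega> * \<bar>?g e\<bar>) \<le> p) \<longleftrightarrow> \<bar>?g e\<bar> \<le> 2 * p / \<omega>" for e
  proof
    obtain t where t: "\<bar>?k t\<bar> = 1/2" using ex_phase_product_half[OF c] \<open>\<omega> > 0\<close> by fastforce
    assume "\<forall>t. \<bar>?k t\<bar> * (\<omega> * \<bar>?g e\<bar>) \<le> p"
    then have "1/2 * (\<omega> * \<bar>?g e\<bar>) \<le> p" using t by metis
    then show "\<bar>?g e\<bar> \<le> 2 * p / \<omega>" using \<open>\<omega> > 0\<close> by (simp add: field_simps)
  next
    assume g: "\<bar>?g e\<bar> \<le> 2 * p / \<omega>"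
    show "\<forall>t. \<bar>?k t\<bar> * (\<omega> * \<bar>?g e\<bar>) \<le> p"
    proof
      fix t
      have "\<bar>?k t\<bar> * (\<omega> * \<bar>?g e\<bar>) \<le> 1/2 * (\<omega> * \<bar>?g e\<bar>)"
        using abs_phase_product_le[OF c] \<open>\<omega> > 0\<close> by (intro mult_right_mono) auto
      also have "\<dots> \<le> p" using g \<open>\<omega> > 0\<close> by (simp add: field_simps)
      finally show "\<bar>?k t\<bar> * (\<omega> * \<bar>?g e\<bar>) \<le> p" .
    qed
  qed
  have "robust_peak_power c1 c2 \<omega> Q S \<le> ereal p \<longleftrightarrow> (\<forall>e. norm e \<le> 1 \<longrightarrow> \<bar>?g e\<bar> \<le> 2 * p / \<omega>)"
    by (simp add: robust_peak_power_def SUP_le_iff power flip: time)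
  also have "\<dots> \<longleftrightarrow> (\<forall>x. \<bar>?g x\<bar> \<le> (2 * p / \<omega>) * (x \<bullet> x))"
  proof (intro iffI allI impI)
    fix x assume ball: "\<forall>e. norm e \<le> 1 \<longrightarrow> \<bar>?g e\<bar> \<le> 2 * p / \<omega>"
    have scale: "?g (r *\<^sub>R x) = r * r * ?g x" for r
      by (simp add: matrix_vector_mult_scaleR)
    show "\<bar>?g x\<bar> \<le> (2 * p / \<omega>) * (x \<bullet> x)"
    proof (cases "x = 0")
      case False
      have "\<bar>?g ((1 / norm x) *\<^sub>R x)\<bar> \<le> 2 * p / \<omega>"
        using ball False by simp
      then have "\<bar>?g x\<bar> / (norm x)^2 \<le> 2 * p / \<omega>"
        unfolding scale by (simp add: abs_mult power2_eq_square)
      then show ?thesis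
        using False by (simp add: power2_norm_eq_inner pos_divide_le_eq)
    qed simp
  next
    fix e :: "real ^ 'q"
    assume all: "\<forall>x. \<bar>?g x\<bar> \<le> (2 * p / \<omega>) * (x \<bullet> x)" and e: "norm e \<le> 1"
    show "\<bar>?g e\<bar> \<le> 2 * p / \<omega>"
    proof (cases "e = 0")
      case True
      \<comment> \<open>The bound at the zero vector needs \<open>p \<ge> 0\<close>; a unit vector provides it.\<close>
      have "0 \<le> 2 * p / \<omega>"
        using all[rule_format, of "axis undefined 1"] by (simp add: inner_axis_axis)
      then show ?thesis using True by simp
    next
      case False
      have "0 \<le> (2 * p / \<omega>) * (e \<bullet> e)" using all[rule_format, of e] by linarith
      then have "0 \<le> 2 * p / \<omega>" using False by (metis inner_gt_zero_iff zero_le_mult_iff not_less)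
      moreover have "e \<bullet> e \<le> 1" using e by (simp add: norm_le_square)
      ultimately have "(2 * p / \<omega>) * (e \<bullet> e) \<le> 2 * p / \<omega>" by (rule mult_left_le[rotated])
      with all show ?thesis by (meson order_trans)
    qed
  qed
  finally show ?thesis .
qed

lemma pseudoinverse_form_nonneg:
  assumes "psd S" and "b \<in> mat_range S"
  shows "0 \<le> b \<bullet> (pseudoinverse S *v b)"
proof -
  have "0 \<le> (pseudoinverse S *v b) \<bullet> (S *v (pseudoinverse S *v b))"
    using assms(1) by (simp add: psd_def)
  then show ?thesis
    by (simp add: pseudoinverse_mult_range[OF assms(2)] inner_commute)
qed

theorem mainTheorem7:
  fixes K1 K2 K3 M1 :: "'e::finite \<Rightarrow> real ^ 'n ^ 'n"
    and M0 S :: "real ^ 'n ^ 'n"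
    and Q :: "real ^ 'q ^ 'n"
    and a :: "real ^ 'e"
    and \<omega> p c1 c2 :: real
  assumes "\<And>e. psd (K1 e)" and "\<And>e. psd (K2 e)" and "\<And>e. psd (K3 e)"
    and "psd M0" and "\<And>e. psd (M1 e)"
    and "\<And>e. 0 \<le> a $ e"
    and "\<omega> > 0" and "p > 0"
    and "c1^2 + c2^2 = 1"
    and "S = stiffness K1 K2 K3 a - \<omega>^2 *\<^sub>R mass M0 M1 a"
  shows "(psd S \<and> mat_range Q \<subseteq> mat_range S \<and> robust_peak_power c1 c2 \<omega> Q S \<le> ereal p)
     \<longleftrightarrow>
     psd (block_matrix ((2 * p / \<omega>) *\<^sub>R mat 1) (- transpose Q)
            (- Q) (stiffness K1 K2 K3 a - \<omega>^2 *\<^sub>R mass M0 M1 a))"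
proof -
  have "robust_peak_power c1 c2 \<omega> Q S \<le> ereal p \<longleftrightarrow>
      (\<forall>x. (Q *v x) \<bullet> (pseudoinverse S *v (Q *v x)) \<le> (2 * p / \<omega>) * (x \<bullet> x))"
    if "psd S" "mat_range Q \<subseteq> mat_range S"
  proof -
    have "0 \<le> (Q *v x) \<bullet> (pseudoinverse S *v (Q *v x))" for x
      using that by (intro pseudoinverse_form_nonneg) (auto simp: mat_range_def)
    then show ?thesis
      unfolding robust_peak_power_le_iff[OF \<open>c1^2 + c2^2 = 1\<close> \<open>\<omega> > 0\<close>] by simp
  qed
  then show ?thesis
    unfolding \<open>S = stiffness K1 K2 K3 a - \<omega>^2 *\<^sub>R mass M0 M1 a\<close>[symmetric]
      psd_block_scaled_mat_iff by blast
qed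

end
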